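(* Let $M\ge 2$, $p>0$ and $q\ge 0$. Consider two complete networks with $M$ nodes: a homogeneous network with $p_i=p$ for all $i$ and $q_{i,j}=\frac{q}{M-1}$ for all $i\ne j$; and a heterogeneous network with $p_1=Mp$, $p_2=p_3=\dots=p_M=0$, $q_{1,2}=q_{1,3}=\dots=q_{1,M}=\frac{2q}{M-1}$, $q_{2,1}=q_{3,1}=\dots=q_{M,1}=0$, and $q_{i,j}=\frac{q}{M-1}$ when $i\neq 1$, $j\ne 1$, $i\ne j$. Let $f^{\rm hom}(t)$ and $f^{\rm het}(t)$ be the respective expected fractions of adopters. Then for all $0<t<\infty$, $$\begin{cases} f^{\rm het}(t)>f^{\rm hom}(t), & \text{if } \frac{q}{M-1}>p,\\ f^{\rm het}(t)=f^{\rm hom}(t), & \text{if } \frac{q}{M-1}=p,\\ f^{\rm het}(t)<f^{\rm hom}(t), & \text{if } \frac{q}{M-1}<p.\end{cases}$$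
   Context: Discrete Bass model: a network has $M$ nodes, external rates $p_j\ge 0$ and internal rates $q_{i,j}\ge 0$ ($i\ne j$; the influence of $i$ on $j$). $X_j(t)\in\{0,1\}$ is the state of node $j$ ($1$ = adopter), $X_j(0)=0$ for all $j$. The process $(X_1,\dots,X_M)$ is a continuous-time Markov chain in which adopters remain adopters forever, and each nonadopter $j$ becomes an adopter at rate $p_j+\sum_{k\ne j}q_{k,j}X_k(t)$ (one node changes at a time). The expected fraction of adopters is $f(t)=\frac1M\,\mathbf{E}\big[\sum_{j=1}^M X_j(t)\big]$. *)

theory Defs
  imports "HOL-Probability.Probability"
begin

text \<open>Generator matrix: \<open>r s s'\<close> is the jump rate from \<open>s\<close> to \<open>s'\<close>; the values \<open>r s s\<close> are irrelevant.\<close>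

definition generator :: "'s set \<Rightarrow> ('s \<Rightarrow> 's \<Rightarrow> real) \<Rightarrow> 's \<Rightarrow> 's \<Rightarrow> real" where
  "generator S r s s' = (if s' = s then - (\<Sum>u\<in>S - {s}. r s u) else r s s')"

text \<open>
  Infinitesimal description of a time-homogeneous continuous-time Markov chain on a finite
  state space \<open>S\<close>. In \<open>markov\<close>, \<open>J\<close> ranges over finite sets of earlier times and \<open>x\<close> over
  histories at these times. In \<open>infinitesimal\<close>, which is
  \<open>P(X (t + h) = s' | X t = s) = \<delta> s s' + generator S r s s' * h + o(h)\<close> for \<open>h \<rightarrow> 0+\<close>, the error
  is uniform in \<open>t\<close>. Both are required only where the conditioning event has positive probability.
\<close>

locale ctmc = prob_space N
  for N :: "'w measure"
  and S :: "'s set"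
  and r :: "'s \<Rightarrow> 's \<Rightarrow> real"
  and X :: "real \<Rightarrow> 'w \<Rightarrow> 's" +
  assumes finite_states: "finite S"
  and random_variables: "t \<ge> 0 \<Longrightarrow> X t \<in> N \<rightarrow>\<^sub>M count_space S"
  and right_continuous:
    "\<lbrakk>\<omega> \<in> space N; t \<ge> 0\<rbrakk> \<Longrightarrow> eventually (\<lambda>u. X u \<omega> = X t \<omega>) (at_right t)"
  and markov:
    "\<lbrakk>t \<ge> 0; h \<ge> 0; finite J; J \<subseteq> {0..t}; s \<in> S; s' \<in> S;
      \<P>(\<omega> in N. X t \<omega> = s \<and> (\<forall>u\<in>J. X u \<omega> = x u)) > 0\<rbrakk> \<Longrightarrow>
      \<P>(\<omega> in N. X (t + h) \<omega> = s' \<bar> X t \<omega> = s \<and> (\<forall>u\<in>J. X u \<omega> = x u)) =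
      \<P>(\<omega> in N. X (t + h) \<omega> = s' \<bar> X t \<omega> = s)"
  and infinitesimal:
    "\<lbrakk>s \<in> S; s' \<in> S; e > 0\<rbrakk> \<Longrightarrow>
      \<exists>d>0. \<forall>t\<ge>0. \<forall>h. 0 < h \<and> h < d \<and> \<P>(\<omega> in N. X t \<omega> = s) > 0 \<longrightarrow>
        \<bar>\<P>(\<omega> in N. X (t + h) \<omega> = s' \<bar> X t \<omega> = s)
          - ((if s' = s then 1 else 0) + generator S r s s' * h)\<bar> \<le> e * h"

text \<open>Nodes are \<open>{1..M}\<close>. A state maps each node to 0 (nonadopter) or 1 (adopter).\<close>

definition bass_states :: "nat \<Rightarrow> (nat \<Rightarrow> nat) set" where
  "bass_states M = ({1..M} \<rightarrow>\<^sub>E {0, 1})"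

text \<open>
  \<open>q k j\<close> is the influence of \<open>k\<close> on \<open>j\<close>; its diagonal is never used. At most one summand is
  nonzero: the one for the unique node \<open>j\<close>, if any, whose adoption turns \<open>s\<close> into \<open>s'\<close>.
\<close>

definition bass_rate ::
  "nat \<Rightarrow> (nat \<Rightarrow> real) \<Rightarrow> (nat \<Rightarrow> nat \<Rightarrow> real) \<Rightarrow> (nat \<Rightarrow> nat) \<Rightarrow> (nat \<Rightarrow> nat) \<Rightarrow> real" where
  "bass_rate M p q s s' =
    (\<Sum>j\<in>{1..M}. if s j = 0 \<and> s' = s(j := 1)
      then p j + (\<Sum>k\<in>{1..M} - {j}. q k j * real (s k)) else 0)"

locale discrete_bass = ctmc N "bass_states M" "bass_rate M p q" X
  for N :: "'w measure"
  and M :: nat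
  and p :: "nat \<Rightarrow> real"
  and q :: "nat \<Rightarrow> nat \<Rightarrow> real"
  and X :: "real \<Rightarrow> 'w \<Rightarrow> nat \<Rightarrow> nat" +
  assumes external_nonneg: "j \<in> {1..M} \<Longrightarrow> p j \<ge> 0"
  and internal_nonneg: "\<lbrakk>i \<in> {1..M}; j \<in> {1..M}; i \<noteq> j\<rbrakk> \<Longrightarrow> q i j \<ge> 0"
  and initially_nonadopters: "\<lbrakk>\<omega> \<in> space N; j \<in> {1..M}\<rbrakk> \<Longrightarrow> X 0 \<omega> j = 0"

definition adopter_fraction ::
  "'w measure \<Rightarrow> nat \<Rightarrow> (real \<Rightarrow> 'w \<Rightarrow> nat \<Rightarrow> nat) \<Rightarrow> real \<Rightarrow> real" where
  "adopter_fraction N M X t = 1 / real M * (\<integral>\<omega>. (\<Sum>j\<in>{1..M}. real (X t \<omega> j)) \<partial>N)"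

definition hom_external :: "real \<Rightarrow> nat \<Rightarrow> real" where
  "hom_external p j = p"

definition hom_internal :: "nat \<Rightarrow> real \<Rightarrow> nat \<Rightarrow> nat \<Rightarrow> real" where
  "hom_internal M q i j = q / (real M - 1)"

definition het_external :: "nat \<Rightarrow> real \<Rightarrow> nat \<Rightarrow> real" where
  "het_external M p j = (if j = 1 then real M * p else 0)"

definition het_internal :: "nat \<Rightarrow> real \<Rightarrow> nat \<Rightarrow> nat \<Rightarrow> real" where
  "het_internal M q i j =
    (if i = 1 then 2 * q / (real M - 1) else if j = 1 then 0 else q / (real M - 1))"

end

theory Submission
  imports Defs
begin

text \<open>
  In both networks the number of adopters is a pure birth process. Writing \<open>a = q / (M - 1)\<close>, the
  homogeneous one jumps from \<open>n\<close> at rate \<open>(M - n) (p + a n)\<close>. In the heterogeneous one node 1 must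
  adopt first, at rate \<open>M p\<close>, and afterwards the rate from \<open>n\<close> is \<open>(M - n) (a + a n)\<close>. The rates agree
  at \<open>n = 0\<close>, and for \<open>1 \<le> n < M\<close> they compare like \<open>p\<close> and \<open>a\<close>. The tail probabilities \<open>Q n\<close> of a
  pure birth process with rates \<open>l n\<close> satisfy \<open>Q (n + 1)' = l n (Q n - Q (n + 1))\<close>, so by induction on
  \<open>n\<close>, with an integrating factor, larger rates give larger tails. The inequality is strict for
  \<open>Q 2\<close>, because the state 1 has positive probability at all positive times. The expected number of
  adopters is the sum of the tails.
\<close>

section \<open>Differential inequalities\<close>

text \<open>The case \<open>e = 1\<close> bounds short increments by \<open>(1 + K) * h\<close>
  uniformly in the starting point, a local Lipschitz estimate. For a point to the left of
  \<open>t\<close> that point is the starting point.\<close>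

lemma continuous_on_of_uniform_increments:
  fixes \<phi> \<psi> :: "real \<Rightarrow> real"
  assumes incr: "\<And>e. e > 0 \<Longrightarrow> \<forall>\<^sub>F h in at_right 0. \<forall>t\<ge>0. \<bar>\<phi> (t + h) - \<phi> t - h * \<psi> t\<bar> \<le> e * h"
    and bdd: "\<And>t. t \<ge> 0 \<Longrightarrow> \<bar>\<psi> t\<bar> \<le> K"
  shows "continuous_on {0..} \<phi>"
  unfolding continuous_on_iff
proof (intro ballI allI impI)
  fix t e :: real
  assume t: "t \<in> {0..}" and e: "e > 0"
  have K: "K \<ge> 0"
    using bdd[of 0] by linarith
  obtain d where d: "d > 0" "\<And>h t. 0 < h \<Longrightarrow> h < d \<Longrightarrow> t \<ge> 0 \<Longrightarrow> \<bar>\<phi> (t + h) - \<phi> t - h * \<psi> t\<bar> \<le> h"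
    using incr[of 1] by (auto simp: eventually_at_right_field)
  have step: "\<bar>\<phi> (u + h) - \<phi> u\<bar> \<le> (1 + K) * h" if "0 \<le> h" "h < d" "u \<ge> 0" for u h
  proof (cases "h = 0")
    case False
    then have "\<bar>\<phi> (u + h) - \<phi> u - h * \<psi> u\<bar> \<le> h"
      using d(2)[of h u] that by auto
    moreover have "\<bar>h * \<psi> u\<bar> \<le> h * K"
      unfolding abs_mult using bdd[of u] that by (simp add: mult_left_mono)
    ultimately show ?thesis
      by (simp add: algebra_simps)
  qed auto
  show "\<exists>d>0. \<forall>y\<in>{0..}. dist y t < d \<longrightarrow> dist (\<phi> y) (\<phi> t) < e"
  proof (intro exI[of _ "min d (e / (1 + K))"] conjI ballI impI)
    show "0 < min d (e / (1 + K))"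
      using d e K by simp
    fix y assume y: "y \<in> {0..}" "dist y t < min d (e / (1 + K))"
    have "\<bar>\<phi> y - \<phi> t\<bar> \<le> (1 + K) * \<bar>y - t\<bar>"
      using step[of "y - t" t] step[of "t - y" y] y t
      by (cases "y \<le> t") (auto simp: dist_real_def abs_if split: if_splits)
    also have "\<dots> < e"
      using y K by (simp add: dist_real_def pos_less_divide_eq mult.commute)
    finally show "dist (\<phi> y) (\<phi> t) < e"
      by (simp add: dist_real_def)
  qed
qed

text \<open>Uniformity in \<open>t\<close> turns the right-sided increments into a two-sided derivative.\<close>

lemma has_derivative_of_uniform_increments:
  fixes \<phi> \<psi> :: "real \<Rightarrow> real"
  assumes incr: "\<And>e. e > 0 \<Longrightarrow> \<forall>\<^sub>F h in at_right 0. \<forall>t\<ge>0. \<bar>\<phi> (t + h) - \<phi> t - h * \<psi> t\<bar> \<le> e * h"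
    and cont: "continuous_on {0..} \<psi>" and t: "t \<ge> 0"
  shows "(\<phi> has_real_derivative \<psi> t) (at t within {0..})"
  unfolding has_field_derivative_iff
proof (rule tendstoI)
  fix e :: real assume e: "e > 0"
  obtain d where d: "d > 0"
      "\<And>h t. 0 < h \<Longrightarrow> h < d \<Longrightarrow> t \<ge> 0 \<Longrightarrow> \<bar>\<phi> (t + h) - \<phi> t - h * \<psi> t\<bar> \<le> e / 2 * h"
    using incr[of "e / 2"] e by (auto simp: eventually_at_right_field)
  obtain d' where d': "d' > 0" "\<And>u. u \<ge> 0 \<Longrightarrow> \<bar>u - t\<bar> < d' \<Longrightarrow> \<bar>\<psi> u - \<psi> t\<bar> < e / 2"
    using cont t e unfolding continuous_on_iff dist_real_def
    by (metis atLeast_iff half_gt_zero)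
  have "\<bar>(\<phi> y - \<phi> t) / (y - t) - \<psi> t\<bar> < e" if y: "y \<ge> 0" "y \<noteq> t" "\<bar>y - t\<bar> < min d d'" for y
  proof -
    \<comment> \<open>For \<open>y < t\<close> the forward increment starts at \<open>y\<close> and
      so approximates \<open>\<psi> y\<close>; continuity of \<open>\<psi>\<close> bridges the gap
      to \<open>\<psi> t\<close>.\<close>
    define u h where "u = min y t" and "h = \<bar>y - t\<bar>"
    have h: "h > 0" "h < d" and u: "u \<ge> 0" "\<bar>u - t\<bar> < d'"
      using y t d'(1) by (auto simp: u_def h_def min_def split: if_splits)
    have quot: "(\<phi> y - \<phi> t) / (y - t) = (\<phi> (u + h) - \<phi> u) / h"
      using y by (cases "y \<le> t") (auto simp: u_def h_def field_simps)
    have "\<bar>(\<phi> (u + h) - \<phi> u) / h - \<psi> u\<bar> = \<bar>\<phi> (u + h) - \<phi> u - h * \<psi> u\<bar> / h"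
      using h by (simp add: diff_divide_distrib abs_div_pos)
    also have "\<dots> \<le> e / 2"
      using d(2)[OF h u(1)] h by (simp add: field_simps)
    finally show ?thesis
      using d'(2)[OF u] quot by linarith
  qed
  then show "\<forall>\<^sub>F y in at t within {0..}. dist ((\<phi> y - \<phi> t) / (y - t)) (\<psi> t) < e"
    unfolding eventually_at using d(1) d'(1)
    by (intro exI[of _ "min d d'"]) (auto simp: dist_real_def)
qed

section \<open>Integrating factors and Gronwall-type bounds\<close>

lemma exp_mult_derivative:
  fixes f g :: "real \<Rightarrow> real"
  assumes "\<And>t. t \<ge> 0 \<Longrightarrow> (f has_real_derivative g t - c * f t) (at t within {0..})" and "t \<ge> 0"
  shows "((\<lambda>t. exp (c * t) * f t) has_real_derivative exp (c * t) * g t) (at t within {0..})"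
  by (rule derivative_eq_intros assms refl)+ (simp add: algebra_simps)

lemma exp_mult_continuous_on:
  fixes f g :: "real \<Rightarrow> real"
  assumes "\<And>t. t \<ge> 0 \<Longrightarrow> (f has_real_derivative g t - c * f t) (at t within {0..})"
  shows "continuous_on {0..t} (\<lambda>t. exp (c * t) * f t)"
proof -
  have "continuous_on {0..} (\<lambda>t. exp (c * t) * f t)"
    by (rule DERIV_continuous_on) (use exp_mult_derivative[OF assms] in auto)
  then show ?thesis
    by (rule continuous_on_subset) auto
qed

lemma at_within_atLeast_0:
  "(t::real) > 0 \<Longrightarrow> at t within {0..} = at t"
  by (rule at_within_interior) (simp add: interior_real_atLeast)

lemma gronwall_le:
  fixes f g :: "real \<Rightarrow> real"
  assumes deriv: "\<And>t. t \<ge> 0 \<Longrightarrow> (f has_real_derivative g t - c * f t) (at t within {0..})"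
    and g: "\<And>t. t > 0 \<Longrightarrow> g t \<ge> 0" and t: "t \<ge> 0"
  shows "f 0 \<le> exp (c * t) * f t"
proof -
  have "exp (c * 0) * f 0 \<le> exp (c * t) * f t"
  proof (rule DERIV_nonneg_imp_increasing_open[OF t])
    fix x assume x: "0 < x" "x < t"
    show "\<exists>y. ((\<lambda>t. exp (c * t) * f t) has_real_derivative y) (at x) \<and> 0 \<le> y"
      using exp_mult_derivative[OF deriv, of x] x g[of x] by (auto simp: at_within_atLeast_0)
  qed (rule exp_mult_continuous_on[OF deriv])
  then show ?thesis by simp
qed

text \<open>Signs are examined on an open interval only, so the source \<open>g\<close> may vanish
  at 0, as it does in \<open>tail_2_less\<close>.\<close>

lemma gronwall_less:
  fixes f g :: "real \<Rightarrow> real"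
  assumes deriv: "\<And>t. t \<ge> 0 \<Longrightarrow> (f has_real_derivative g t - c * f t) (at t within {0..})"
    and g: "\<And>t. t > 0 \<Longrightarrow> g t > 0" and t: "t > 0"
  shows "f 0 < exp (c * t) * f t"
proof -
  have "exp (c * 0) * f 0 < exp (c * t) * f t"
  proof (rule DERIV_pos_imp_increasing_open[OF t])
    fix x assume x: "0 < x" "x < t"
    show "\<exists>y. ((\<lambda>t. exp (c * t) * f t) has_real_derivative y) (at x) \<and> 0 < y"
      using exp_mult_derivative[OF deriv, of x] x g[of x] by (auto simp: at_within_atLeast_0)
  qed (rule exp_mult_continuous_on[OF deriv])
  then show ?thesis by simp
qed

section \<open>Comparison of pure birth processes\<close>

text \<open>\<open>Q n t\<close> is the probability that a pure birth process started at 0 has reached \<open>n\<close> by time \<open>t\<close>.\<close>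

locale birth_tails =
  fixes l :: "nat \<Rightarrow> real" and Q :: "nat \<Rightarrow> real \<Rightarrow> real"
  assumes tail_0: "t \<ge> 0 \<Longrightarrow> Q 0 t = 1"
    and tail_init: "Q (Suc n) 0 = 0"
    and tail_antimono: "t \<ge> 0 \<Longrightarrow> Q (Suc n) t \<le> Q n t"
    and tail_deriv: "t \<ge> 0 \<Longrightarrow> (Q (Suc n) has_real_derivative l n * (Q n t - Q (Suc n) t)) (at t within {0..})"
begin

text \<open>The function \<open>1 - Q 1\<close> solves \<open>f' = - l 0 * f\<close> with value 1 at
  time 0, so it stays positive.\<close>

lemma state_0_pos:
  assumes "t \<ge> 0"
  shows "Q 0 t - Q (Suc 0) t > 0"
proof -
  have "1 - Q (Suc 0) 0 \<le> exp (l 0 * t) * (1 - Q (Suc 0) t)"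
  proof (rule gronwall_le[where g = "\<lambda>_. 0", OF _ _ assms])
    show "((\<lambda>t. 1 - Q (Suc 0) t) has_real_derivative 0 - l 0 * (1 - Q (Suc 0) t)) (at t within {0..})"
      if "t \<ge> 0" for t
      using that by (auto intro!: derivative_eq_intros tail_deriv simp: tail_0)
  qed auto
  then have "0 < exp (l 0 * t) * (1 - Q (Suc 0) t)"
    by (simp add: tail_init)
  then show ?thesis
    using assms by (simp add: tail_0 zero_less_mult_iff)
qed

text \<open>The mass of state 1 starts at 0 and is fed by the positive source
  \<open>l 0 * (Q 0 t - Q 1 t)\<close>; the integrating factor absorbs the loss term.\<close>

lemma state_1_pos:
  assumes "l 0 > 0" "t > 0"
  shows "Q 1 t - Q 2 t > 0"
proof -
  have "Q (Suc 0) 0 - Q (Suc 1) 0 < exp (l 1 * t) * (Q (Suc 0) t - Q (Suc 1) t)"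
  proof (rule gronwall_less[where g = "\<lambda>t. l 0 * (Q 0 t - Q (Suc 0) t)", OF _ _ assms(2)])
    show "((\<lambda>t. Q (Suc 0) t - Q (Suc 1) t) has_real_derivative
        l 0 * (Q 0 t - Q (Suc 0) t) - l 1 * (Q (Suc 0) t - Q (Suc 1) t)) (at t within {0..})"
      if "t \<ge> 0" for t
      using that by (auto intro!: derivative_eq_intros tail_deriv)
  qed (use assms state_0_pos in auto)
  then show ?thesis
    by (simp add: tail_init zero_less_mult_iff numeral_2_eq_2)
qed

end

locale birth_tails_pair = lo: birth_tails l Q + hi: birth_tails m R for l Q m R
begin

text \<open>With \<open>m n\<close> as damping constant two sources remain: the difference at the
  previous level, and the gap between the rates times the mass of state \<open>n\<close> under
  \<open>Q\<close>.\<close>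

lemma diff_deriv:
  assumes "t \<ge> 0"
  shows "((\<lambda>t. R (Suc n) t - Q (Suc n) t) has_real_derivative
    (m n * (R n t - Q n t) + (m n - l n) * (Q n t - Q (Suc n) t))
      - m n * (R (Suc n) t - Q (Suc n) t)) (at t within {0..})"
  using assms
  by (auto intro!: derivative_eq_intros lo.tail_deriv hi.tail_deriv simp: algebra_simps)

text \<open>In \<open>diff_deriv\<close> the first source is nonnegative by induction, the second
  because the rates are ordered and \<open>Q\<close> decreases in \<open>n\<close>.\<close>

lemma tail_le:
  assumes "\<And>n. 0 \<le> m n" "\<And>n. l n \<le> m n" "t \<ge> 0"
  shows "Q n t \<le> R n t"
  using assms(3)
proof (induction n arbitrary: t)
  case (Suc n)
  have "R (Suc n) 0 - Q (Suc n) 0 \<le> exp (m n * t) * (R (Suc n) t - Q (Suc n) t)"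
  proof (rule gronwall_le[OF diff_deriv _ Suc.prems])
    show "0 \<le> m n * (R n t - Q n t) + (m n - l n) * (Q n t - Q (Suc n) t)" if "t > 0" for t
      using that Suc.IH[of t] assms(1,2)[of n] lo.tail_antimono[of t n] by simp
  qed
  then show ?case
    by (simp add: lo.tail_init hi.tail_init zero_le_mult_iff)
qed (simp add: lo.tail_0 hi.tail_0)

text \<open>Strictness comes from the second source: the rates differ at 1, and
  \<open>state_1_pos\<close> gives the slower process positive mass there. Level 2 is the first tail
  that the rate at 1 affects.\<close>

lemma tail_2_less:
  assumes "\<And>n. 0 \<le> m n" "\<And>n. l n \<le> m n" "l 0 > 0" "l 1 < m 1" "t > 0"
  shows "Q 2 t < R 2 t"
proof -
  have "R (Suc 1) 0 - Q (Suc 1) 0 < exp (m 1 * t) * (R (Suc 1) t - Q (Suc 1) t)"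
  proof (rule gronwall_less[OF diff_deriv _ assms(5)])
    show "0 < m 1 * (R 1 t - Q 1 t) + (m 1 - l 1) * (Q 1 t - Q (Suc 1) t)" if "t > 0" for t
      using that assms tail_le[of t 1] lo.state_1_pos[of t]
      by (intro add_nonneg_pos mult_nonneg_nonneg mult_pos_pos) (auto simp: numeral_2_eq_2)
  qed
  then show ?thesis
    by (simp add: lo.tail_init hi.tail_init zero_less_mult_iff numeral_2_eq_2)
qed

lemma sum_tails_less:
  assumes "\<And>n. 0 \<le> m n" "\<And>n. l n \<le> m n" "l 0 > 0" "l 1 < m 1" "t > 0" "M \<ge> 2"
  shows "(\<Sum>k\<in>{1..M}. Q k t) < (\<Sum>k\<in>{1..M}. R k t)"
  using assms tail_le tail_2_less
  by (intro sum_strict_mono_ex1) (auto intro!: bexI[of _ 2])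

end

section \<open>The Kolmogorov forward equation\<close>

context ctmc
begin

lemma measurable_obs [measurable]:
  fixes g :: "'s \<Rightarrow> real"
  assumes "t \<ge> 0"
  shows "(\<lambda>\<omega>. g (X t \<omega>)) \<in> borel_measurable N"
  by (rule measurable_compose[OF random_variables[OF assms]]) simp

lemma state_in: "t \<ge> 0 \<Longrightarrow> \<omega> \<in> space N \<Longrightarrow> X t \<omega> \<in> S"
  using measurable_space[OF random_variables] by fastforce

text \<open>Since \<open>s\<close> may lie outside \<open>S\<close>, \<open>{s}\<close> need not be
  measurable in \<open>count_space S\<close>; a real-valued indicator is used instead.\<close>

lemma state_event: "t \<ge> 0 \<Longrightarrow> {\<omega> \<in> space N. X t \<omega> = s} \<in> events"
proof -
  assume t: "t \<ge> 0"
  have "{\<omega> \<in> space N. (if X t \<omega> = s then 1 else 0 :: real) = 1} \<in> events"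
    using measurable_obs[OF t, of "\<lambda>x. if x = s then 1 else 0"] by measurable
  also have "{\<omega> \<in> space N. (if X t \<omega> = s then 1 else 0 :: real) = 1} = {\<omega> \<in> space N. X t \<omega> = s}"
    by auto
  finally show ?thesis .
qed

lemma obs_bounded:
  fixes g :: "'s \<Rightarrow> real"
  assumes "t \<ge> 0" "\<omega> \<in> space N"
  shows "\<bar>g (X t \<omega>)\<bar> \<le> (\<Sum>s\<in>S. \<bar>g s\<bar>)"
  using assms state_in finite_states by (intro member_le_sum[of _ S "\<lambda>s. \<bar>g s\<bar>"]) auto

lemma obs_integrable:
  fixes g :: "'s \<Rightarrow> real"
  assumes "t \<ge> 0"
  shows "integrable N (\<lambda>\<omega>. g (X t \<omega>))"
  by (rule integrable_const_bound[where B = "\<Sum>s\<in>S. \<bar>g s\<bar>"])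
     (use obs_bounded assms in \<open>auto intro!: AE_I2\<close>)

lemma obs_expectation_bounded:
  fixes g :: "'s \<Rightarrow> real"
  assumes "t \<ge> 0"
  shows "\<bar>expectation (\<lambda>\<omega>. g (X t \<omega>))\<bar> \<le> (\<Sum>s\<in>S. \<bar>g s\<bar>)"
proof -
  have "\<bar>expectation (\<lambda>\<omega>. g (X t \<omega>))\<bar> \<le> expectation (\<lambda>\<omega>. \<bar>g (X t \<omega>)\<bar>)"
    by (rule integral_abs_bound)
  also have "\<dots> \<le> (\<Sum>s\<in>S. \<bar>g s\<bar>)"
    by (rule integral_le_const) (use obs_bounded obs_integrable assms in \<open>auto intro!: AE_I2\<close>)
  finally show ?thesis .
qed

lemma expectation_obs:
  fixes g :: "'s \<Rightarrow> real"
  assumes t: "t \<ge> 0"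
  shows "expectation (\<lambda>\<omega>. g (X t \<omega>)) = (\<Sum>s\<in>S. g s * \<P>(\<omega> in N. X t \<omega> = s))"
proof -
  have "expectation (\<lambda>\<omega>. g (X t \<omega>)) =
      expectation (\<lambda>\<omega>. \<Sum>s\<in>S. g s * indicator {\<omega> \<in> space N. X t \<omega> = s} \<omega>)"
  proof (rule Bochner_Integration.integral_cong[OF refl])
    fix \<omega> assume \<omega>: "\<omega> \<in> space N"
    then have "(\<Sum>s\<in>S. g s * indicator {\<omega> \<in> space N. X t \<omega> = s} \<omega>) = (\<Sum>s\<in>S. if X t \<omega> = s then g s else 0)"
      by (intro sum.cong) (auto simp: indicator_def)
    with \<omega> show "g (X t \<omega>) = (\<Sum>s\<in>S. g s * indicator {\<omega> \<in> space N. X t \<omega> = s} \<omega>)"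
      using state_in[OF t] finite_states by (simp add: sum.delta')
  qed
  also have "\<dots> = (\<Sum>s\<in>S. expectation (\<lambda>\<omega>. g s * indicator {\<omega> \<in> space N. X t \<omega> = s} \<omega>))"
    using state_event[OF t]
    by (intro Bochner_Integration.integral_sum integrable_mult_right integrable_real_indicator)
       (auto simp: emeasure_eq_measure)
  also have "\<dots> = (\<Sum>s\<in>S. g s * \<P>(\<omega> in N. X t \<omega> = s))"
    using state_event[OF t] by (intro sum.cong) auto
  finally show ?thesis .
qed

lemma prob_joint_sum:
  assumes "t \<ge> 0" "h \<ge> 0"
  shows "\<P>(\<omega> in N. X (t + h) \<omega> = s') = (\<Sum>s\<in>S. \<P>(\<omega> in N. X (t + h) \<omega> = s' \<and> X t \<omega> = s))"
proof -
  have "{\<omega> \<in> space N. X (t + h) \<omega> = s' \<and> X t \<omega> = s} \<in> events" for s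
    using state_event[of "t + h" s'] state_event[of t s] assms by (auto intro: sets.sets_Collect_conj)
  then have "(\<Sum>s\<in>S. \<P>(\<omega> in N. X (t + h) \<omega> = s' \<and> X t \<omega> = s)) =
      prob (\<Union>s\<in>S. {\<omega> \<in> space N. X (t + h) \<omega> = s' \<and> X t \<omega> = s})"
    using finite_states by (intro finite_measure_finite_Union[symmetric]) (auto simp: disjoint_family_on_def)
  also have "(\<Union>s\<in>S. {\<omega> \<in> space N. X (t + h) \<omega> = s' \<and> X t \<omega> = s}) = {\<omega> \<in> space N. X (t + h) \<omega> = s'}"
    using state_in[OF assms(1)] by auto
  finally show ?thesis by simp
qed

text \<open>Passing from conditional to joint probabilities multiplies the error by a factor at most
  1 and removes the positivity condition: if \<open>s\<close> has probability 0, both terms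
  vanish.\<close>

lemma joint_increment:
  assumes "s \<in> S" "s' \<in> S" "e > 0"
  shows "\<forall>\<^sub>F h in at_right 0. \<forall>t\<ge>0.
    \<bar>\<P>(\<omega> in N. X (t + h) \<omega> = s' \<and> X t \<omega> = s)
      - ((if s' = s then 1 else 0) + generator S r s s' * h) * \<P>(\<omega> in N. X t \<omega> = s)\<bar> \<le> e * h"
proof -
  obtain d where d: "d > 0" "\<And>t h. t \<ge> 0 \<Longrightarrow> 0 < h \<Longrightarrow> h < d \<Longrightarrow> \<P>(\<omega> in N. X t \<omega> = s) > 0 \<Longrightarrow>
      \<bar>\<P>(\<omega> in N. X (t + h) \<omega> = s' \<bar> X t \<omega> = s)
          - ((if s' = s then 1 else 0) + generator S r s s' * h)\<bar> \<le> e * h"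
    using infinitesimal[OF assms] by blast
  have "\<bar>\<P>(\<omega> in N. X (t + h) \<omega> = s' \<and> X t \<omega> = s)
      - ((if s' = s then 1 else 0) + generator S r s s' * h) * \<P>(\<omega> in N. X t \<omega> = s)\<bar> \<le> e * h"
    if h: "0 < h" "h < d" and t: "t \<ge> 0" for t h
  proof (cases "\<P>(\<omega> in N. X t \<omega> = s) > 0")
    case True
    let ?p = "\<P>(\<omega> in N. X t \<omega> = s)"
    have "\<P>(\<omega> in N. X (t + h) \<omega> = s' \<and> X t \<omega> = s)
      - ((if s' = s then 1 else 0) + generator S r s s' * h) * ?p =
      (\<P>(\<omega> in N. X (t + h) \<omega> = s' \<bar> X t \<omega> = s)
          - ((if s' = s then 1 else 0) + generator S r s s' * h)) * ?p"
      using True by (simp add: cond_prob_def field_simps)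
    also have "\<bar>\<dots>\<bar> \<le> e * h * 1"
      unfolding abs_mult by (rule mult_mono) (use d(2)[OF t h True] h assms in auto)
    finally show ?thesis by simp
  next
    case False
    then have 0: "\<P>(\<omega> in N. X t \<omega> = s) = 0"
      by (simp add: zero_less_measure_iff)
    moreover have "\<P>(\<omega> in N. X (t + h) \<omega> = s' \<and> X t \<omega> = s) \<le> \<P>(\<omega> in N. X t \<omega> = s)"
      using state_event[OF t, of s] by (intro finite_measure_mono) auto
    ultimately have "\<P>(\<omega> in N. X (t + h) \<omega> = s' \<and> X t \<omega> = s) = 0"
      by (simp add: measure_le_0_iff)
    then show ?thesis
      using 0 h assms by simp
  qed
  then show ?thesis
    unfolding eventually_at_right_field using d(1) by auto
qed

text \<open>The generator as an operator on functions of the state (the backward operator).\<close>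

definition gen :: "('s \<Rightarrow> real) \<Rightarrow> 's \<Rightarrow> real" where
  "gen g s = (\<Sum>s'\<in>S. generator S r s s' * g s')"

text \<open>The rows of the generator sum to zero, so the diagonal entry supplies exactly the terms
  \<open>- r s u * g s\<close>.\<close>

lemma gen_eq:
  assumes "s \<in> S"
  shows "gen g s = (\<Sum>u\<in>S - {s}. r s u * (g u - g s))"
proof -
  have "gen g s = generator S r s s * g s + (\<Sum>u\<in>S - {s}. generator S r s u * g u)"
    unfolding gen_def using assms finite_states by (simp add: sum.remove)
  also have "(\<Sum>u\<in>S - {s}. generator S r s u * g u) = (\<Sum>u\<in>S - {s}. r s u * g u)"
    by (intro sum.cong) (auto simp: generator_def)
  finally show ?thesis
    by (simp add: generator_def right_diff_distrib sum_subtractf sum_distrib_right)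
qed

lemma expectation_increment:
  fixes g :: "'s \<Rightarrow> real"
  assumes "e > 0"
  shows "\<forall>\<^sub>F h in at_right 0. \<forall>t\<ge>0.
    \<bar>expectation (\<lambda>\<omega>. g (X (t + h) \<omega>)) - expectation (\<lambda>\<omega>. g (X t \<omega>))
      - h * expectation (\<lambda>\<omega>. gen g (X t \<omega>))\<bar> \<le> e * h"
proof -
  \<comment> \<open>\<open>K\<close> is the total weight of the errors of single pairs of states;
    the \<open>+ 1\<close> below keeps the denominator positive when \<open>K = 0\<close>.\<close>
  define K where "K = (\<Sum>s'\<in>S. \<Sum>s\<in>S. \<bar>g s'\<bar>)"
  have K: "K \<ge> 0"
    by (auto simp: K_def intro!: sum_nonneg)
  define e' where "e' = e / (K + 1)"
  have e': "e' > 0"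
    using assms K by (simp add: e'_def)
  have e'K: "e' * K \<le> e"
    using assms K by (simp add: e'_def field_simps)
  let ?J = "\<lambda>t h s s'. \<P>(\<omega> in N. X (t + h) \<omega> = s' \<and> X t \<omega> = s)"
  let ?P = "\<lambda>t s. \<P>(\<omega> in N. X t \<omega> = s)"
  let ?A = "\<lambda>t h s s'. ((if s' = s then 1 else 0) + generator S r s s' * h) * ?P t s"
  have "\<forall>\<^sub>F h in at_right 0. \<forall>s\<in>S. \<forall>s'\<in>S. \<forall>t\<ge>0. \<bar>?J t h s s' - ?A t h s s'\<bar> \<le> e' * h"
    using joint_increment e' finite_states by (simp add: eventually_ball_finite)
  moreover have "\<forall>\<^sub>F h in at_right 0. h > (0::real)"
    by (simp add: eventually_at_right_less)
  ultimately show ?thesis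
  proof eventually_elim
    case (elim h)
    show ?case
    proof (intro allI impI)
      fix t :: real assume t: "t \<ge> 0"
      have 1: "expectation (\<lambda>\<omega>. g (X (t + h) \<omega>)) = (\<Sum>s'\<in>S. \<Sum>s\<in>S. g s' * ?J t h s s')"
        using t elim(2) by (simp add: expectation_obs prob_joint_sum sum_distrib_left)
      \<comment> \<open>The diagonal term selects \<open>s' = s\<close>; summing the generator term
        over \<open>s'\<close> produces \<open>gen g s\<close>.\<close>
      have "(\<Sum>s'\<in>S. \<Sum>s\<in>S. g s' * ?A t h s s') =
          (\<Sum>s\<in>S. \<Sum>s'\<in>S. (if s' = s then g s' * ?P t s else 0) + h * (generator S r s s' * g s' * ?P t s))"
        by (subst sum.swap) (intro sum.cong, auto simp: algebra_simps)
      also have "\<dots> = (\<Sum>s\<in>S. g s * ?P t s + h * (gen g s * ?P t s))"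
        using finite_states
        by (intro sum.cong) (auto simp: sum.distrib gen_def sum_distrib_left sum_distrib_right)
      also have "\<dots> = expectation (\<lambda>\<omega>. g (X t \<omega>)) + h * expectation (\<lambda>\<omega>. gen g (X t \<omega>))"
        using t by (simp add: expectation_obs sum.distrib sum_distrib_left)
      finally have 2: "expectation (\<lambda>\<omega>. g (X t \<omega>)) + h * expectation (\<lambda>\<omega>. gen g (X t \<omega>)) =
        (\<Sum>s'\<in>S. \<Sum>s\<in>S. g s' * ?A t h s s')" ..
      have "\<bar>expectation (\<lambda>\<omega>. g (X (t + h) \<omega>)) - expectation (\<lambda>\<omega>. g (X t \<omega>))
          - h * expectation (\<lambda>\<omega>. gen g (X t \<omega>))\<bar> =
          \<bar>\<Sum>s'\<in>S. \<Sum>s\<in>S. g s' * (?J t h s s' - ?A t h s s')\<bar>"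
        using 1 2 by (simp add: right_diff_distrib sum_subtractf)
      also have "\<dots> \<le> (\<Sum>s'\<in>S. \<Sum>s\<in>S. \<bar>g s'\<bar> * (e' * h))"
        using elim(1) t
        by (intro sum_abs[THEN order_trans] sum_mono) (simp add: abs_mult mult_left_mono)
      also have "\<dots> = e' * K * h"
        by (simp add: K_def sum_distrib_left sum_distrib_right mult_ac)
      also have "\<dots> \<le> e * h"
        using e'K elim(2) by (simp add: mult_right_mono)
      finally show "\<bar>expectation (\<lambda>\<omega>. g (X (t + h) \<omega>)) - expectation (\<lambda>\<omega>. g (X t \<omega>))
          - h * expectation (\<lambda>\<omega>. gen g (X t \<omega>))\<bar> \<le> e * h" .
    qed
  qed
qed

text \<open>This is the forward equation in weak form. The right-hand side is continuous by the
  increment estimate for \<open>gen g\<close>, since \<open>gen (gen g)\<close> has bounded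
  expectation.\<close>

lemma expectation_derivative:
  fixes g :: "'s \<Rightarrow> real"
  assumes "t \<ge> 0"
  shows "((\<lambda>t. expectation (\<lambda>\<omega>. g (X t \<omega>))) has_real_derivative
    expectation (\<lambda>\<omega>. gen g (X t \<omega>))) (at t within {0..})"
proof (rule has_derivative_of_uniform_increments[OF _ _ assms])
  show "continuous_on {0..} (\<lambda>t. expectation (\<lambda>\<omega>. gen g (X t \<omega>)))"
    by (rule continuous_on_of_uniform_increments[OF expectation_increment])
       (auto intro: obs_expectation_bounded)
qed (rule expectation_increment)

end

section \<open>Counting adopters\<close>

definition adopters :: "nat \<Rightarrow> (nat \<Rightarrow> nat) \<Rightarrow> nat" where
  "adopters M s = (\<Sum>j\<in>{1..M}. s j)"

definition adoption_rate ::
  "nat \<Rightarrow> (nat \<Rightarrow> real) \<Rightarrow> (nat \<Rightarrow> nat \<Rightarrow> real) \<Rightarrow> (nat \<Rightarrow> nat) \<Rightarrow> nat \<Rightarrow> real" where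
  "adoption_rate M p q s j = p j + (\<Sum>k\<in>{1..M} - {j}. q k j * real (s k))"

lemma bass_states_cases:
  assumes "s \<in> bass_states M" "j \<in> {1..M}"
  obtains "s j = 0" | "s j = 1"
proof -
  have "s j \<in> {0, 1}"
    using assms unfolding bass_states_def by (rule PiE_mem)
  then show thesis
    using that by auto
qed

lemma adopt_in_bass_states:
  "s \<in> bass_states M \<Longrightarrow> j \<in> {1..M} \<Longrightarrow> s(j := 1) \<in> bass_states M"
  by (auto simp: bass_states_def PiE_iff extensional_def)

lemma adopters_adopt:
  assumes "s j = 0" "j \<in> {1..M}"
  shows "adopters M (s(j := 1)) = Suc (adopters M s)"
proof -
  have "(\<Sum>i\<in>{1..M} - {j}. (s(j := 1)) i) = (\<Sum>i\<in>{1..M} - {j}. s i)"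
    by (intro sum.cong) auto
  then show ?thesis
    using assms by (simp add: adopters_def sum.remove[of _ j])
qed

text \<open>The node \<open>j\<close> itself contributes 0, so equal weights make the influence on a
  nonadopter a function of the count.\<close>

lemma adopters_others:
  assumes "s j = 0" "j \<in> {1..M}"
  shows "(\<Sum>k\<in>{1..M} - {j}. real (s k)) = real (adopters M s)"
  using assms by (simp add: adopters_def sum.remove[of _ j])

text \<open>Each node contributes 1 to exactly one of the two counts. The bound ensures that the
  truncated subtraction loses nothing.\<close>

lemma card_nonadopters:
  assumes "s \<in> bass_states M"
  shows "card {j\<in>{1..M}. s j = 0} = M - adopters M s" and "adopters M s \<le> M"
proof -
  have "card {j\<in>{1..M}. s j = 0} + adopters M s = (\<Sum>j\<in>{1..M}. (if s j = 0 then 1 else 0) + s j)"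
    by (simp add: sum.distrib adopters_def flip: sum.inter_filter)
  also have "\<dots> = (\<Sum>j\<in>{1..M}. 1)"
    using assms by (intro sum.cong) (auto elim: bass_states_cases)
  finally show "card {j\<in>{1..M}. s j = 0} = M - adopters M s" "adopters M s \<le> M"
    by auto
qed

section \<open>The adopter count under the Bass dynamics\<close>

context discrete_bass
begin

text \<open>After swapping the sums over targets and nodes, each nonadopter \<open>j\<close> has the
  single target \<open>s(j := 1)\<close>, a state different from \<open>s\<close>.\<close>

lemma gen_bass:
  assumes s: "s \<in> bass_states M"
  shows "gen g s = (\<Sum>j\<in>{j\<in>{1..M}. s j = 0}. adoption_rate M p q s j * (g (s(j := 1)) - g s))"
proof -
  have "gen g s = (\<Sum>u\<in>bass_states M - {s}. \<Sum>j\<in>{1..M}.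
      if s j = 0 \<and> u = s(j := 1) then adoption_rate M p q s j * (g u - g s) else 0)"
    unfolding gen_eq[OF s] bass_rate_def
    by (simp add: sum_distrib_right adoption_rate_def if_distrib[of "\<lambda>x. x * _"] cong: if_cong)
  also have "\<dots> = (\<Sum>j\<in>{1..M}. \<Sum>u\<in>bass_states M - {s}.
      if u = s(j := 1) then (if s j = 0 then adoption_rate M p q s j * (g u - g s) else 0) else 0)"
    by (subst sum.swap) (intro sum.cong, auto)
  also have "\<dots> = (\<Sum>j\<in>{1..M}. if s j = 0 then adoption_rate M p q s j * (g (s(j := 1)) - g s) else 0)"
  proof (intro sum.cong refl)
    fix j assume j: "j \<in> {1..M}"
    have "s(j := 1) \<noteq> s" if "s j = 0"
      using that by (metis fun_upd_same zero_neq_one)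
    then show "(\<Sum>u\<in>bass_states M - {s}. if u = s(j := 1) then
        (if s j = 0 then adoption_rate M p q s j * (g u - g s) else 0) else 0) =
        (if s j = 0 then adoption_rate M p q s j * (g (s(j := 1)) - g s) else 0)"
      using finite_states adopt_in_bass_states[OF s j] by auto
  qed
  finally show ?thesis
    by (subst sum.inter_filter) simp_all
qed

definition tail :: "nat \<Rightarrow> real \<Rightarrow> real" where
  "tail n t = expectation (\<lambda>\<omega>. of_bool (n \<le> adopters M (X t \<omega>)))"

text \<open>An adoption raises the count by one, so the indicator changes only from count
  \<open>n\<close>, and by the same amount whichever node adopts.\<close>

lemma gen_tail:
  assumes "s \<in> bass_states M"
  shows "gen (\<lambda>s. of_bool (Suc n \<le> adopters M s)) s =
    (\<Sum>j\<in>{j\<in>{1..M}. s j = 0}. adoption_rate M p q s j) *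
      (of_bool (n \<le> adopters M s) - of_bool (Suc n \<le> adopters M s))"
  unfolding gen_bass[OF assms] sum_distrib_right
  by (intro sum.cong) (auto simp: adopters_adopt[unfolded One_nat_def])

text \<open>This lumps the chain to its adopter count. An almost sure hypothesis suffices under the
  expectation and leaves room for the states that the heterogeneous network almost surely
  avoids.\<close>

lemma birth_tails_of_total_rate:
  assumes rate: "\<And>t. t \<ge> 0 \<Longrightarrow> AE \<omega> in N.
      (\<Sum>j\<in>{j\<in>{1..M}. X t \<omega> j = 0}. adoption_rate M p q (X t \<omega>) j) = l (adopters M (X t \<omega>))"
  shows "birth_tails l tail"
proof
  fix t :: real and n
  show "tail (Suc n) 0 = 0"
  proof -
    have "tail (Suc n) 0 = expectation (\<lambda>_. 0)"
      unfolding tail_def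
      by (rule Bochner_Integration.integral_cong) (auto simp: adopters_def initially_nonadopters)
    then show ?thesis by simp
  qed
  assume t: "t \<ge> 0"
  show "tail 0 t = 1"
    by (simp add: tail_def prob_space)
  show "tail (Suc n) t \<le> tail n t"
    unfolding tail_def
    by (rule integral_mono)
       (use obs_integrable[OF t, of "\<lambda>s. of_bool (_ \<le> adopters M s)"] in auto)
  have "expectation (\<lambda>\<omega>. gen (\<lambda>s. of_bool (Suc n \<le> adopters M s)) (X t \<omega>)) =
      expectation (\<lambda>\<omega>. l n * (of_bool (n \<le> adopters M (X t \<omega>)) - of_bool (Suc n \<le> adopters M (X t \<omega>))))"
  proof (rule integral_cong_AE)
    show "(\<lambda>\<omega>. gen (\<lambda>s. of_bool (Suc n \<le> adopters M s)) (X t \<omega>)) \<in> borel_measurable N"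
      by (rule measurable_obs[OF t])
    show "(\<lambda>\<omega>. l n * (of_bool (n \<le> adopters M (X t \<omega>)) - of_bool (Suc n \<le> adopters M (X t \<omega>))))
        \<in> borel_measurable N"
      by (rule measurable_obs[OF t, of "\<lambda>s. l n * (of_bool (n \<le> adopters M s) - of_bool (Suc n \<le> adopters M s))"])
    show "AE \<omega> in N. gen (\<lambda>s. of_bool (Suc n \<le> adopters M s)) (X t \<omega>) =
        l n * (of_bool (n \<le> adopters M (X t \<omega>)) - of_bool (Suc n \<le> adopters M (X t \<omega>)))"
      using rate[OF t] AE_space
    proof eventually_elim
      case (elim \<omega>)
      show ?case
        unfolding gen_tail[OF state_in[OF t elim(2)]] elim(1)
        \<comment> \<open>Away from count \<open>n\<close> the difference of indicators is 0, so
          \<open>l\<close> at the actual count may be replaced by \<open>l n\<close>.\<close>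
        by (cases "adopters M (X t \<omega>) = n") auto
    qed
  qed
  also have "\<dots> = l n * (tail n t - tail (Suc n) t)"
    unfolding tail_def
    using obs_integrable[OF t, of "\<lambda>s. of_bool (_ \<le> adopters M s)"] by simp
  finally show "(tail (Suc n) has_real_derivative l n * (tail n t - tail (Suc n) t)) (at t within {0..})"
    using expectation_derivative[OF t, of "\<lambda>s. of_bool (Suc n \<le> adopters M s)"]
    by (simp add: tail_def[abs_def])
qed

text \<open>A count between 0 and \<open>M\<close> equals the number of levels in
  \<open>{1..M}\<close> that it reaches.\<close>

lemma adopter_fraction_eq_tails:
  assumes t: "t \<ge> 0"
  shows "adopter_fraction N M X t = 1 / real M * (\<Sum>k\<in>{1..M}. tail k t)"
proof -
  have "real (adopters M s) = (\<Sum>k\<in>{1..M}. of_bool (k \<le> adopters M s))" if "s \<in> bass_states M" for s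
  proof -
    have "{1..M} \<inter> {k. k \<le> adopters M s} = {1..adopters M s}"
      using card_nonadopters(2)[OF that] by auto
    then show ?thesis
      by simp
  qed
  then have "expectation (\<lambda>\<omega>. \<Sum>j\<in>{1..M}. real (X t \<omega> j)) =
      expectation (\<lambda>\<omega>. \<Sum>k\<in>{1..M}. of_bool (k \<le> adopters M (X t \<omega>)))"
    using state_in[OF t]
    by (intro Bochner_Integration.integral_cong) (auto simp: adopters_def)
  also have "\<dots> = (\<Sum>k\<in>{1..M}. tail k t)"
    unfolding tail_def
    using obs_integrable[OF t, of "\<lambda>s. of_bool (_ \<le> adopters M s)"]
    by (intro Bochner_Integration.integral_sum) auto
  finally show ?thesis
    by (simp add: adopter_fraction_def)
qed

end

section \<open>The two networks\<close>

text \<open>Truncated subtraction makes the rates vanish beyond \<open>M\<close>, so they compare for every \<open>n\<close>.\<close>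

definition hom_rate :: "nat \<Rightarrow> real \<Rightarrow> real \<Rightarrow> nat \<Rightarrow> real" where
  "hom_rate M p a n = real (M - n) * (p + a * real n)"

definition het_rate :: "nat \<Rightarrow> real \<Rightarrow> real \<Rightarrow> nat \<Rightarrow> real" where
  "het_rate M p a n = (if n = 0 then real M * p else real (M - n) * (a + a * real n))"

text \<open>In every state with \<open>n\<close> adopters, each of the \<open>M - n\<close>
  nonadopters has the same rate \<open>p + q / (M - 1) * n\<close>.\<close>

lemma hom_birth_tails:
  assumes "discrete_bass N M (hom_external p) (hom_internal M q) X"
  shows "birth_tails (hom_rate M p (q / (real M - 1))) (discrete_bass.tail N M X)"
proof -
  interpret discrete_bass N M "hom_external p" "hom_internal M q" X
    by (rule assms)
  have "(\<Sum>j\<in>{j\<in>{1..M}. s j = 0}. adoption_rate M (hom_external p) (hom_internal M q) s j) =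
      hom_rate M p (q / (real M - 1)) (adopters M s)" if "s \<in> bass_states M" for s
  proof -
    have "(\<Sum>j\<in>{j\<in>{1..M}. s j = 0}. adoption_rate M (hom_external p) (hom_internal M q) s j) =
      (\<Sum>j\<in>{j\<in>{1..M}. s j = 0}. p + q / (real M - 1) * real (adopters M s))"
      by (intro sum.cong)
         (auto simp: adoption_rate_def hom_external_def hom_internal_def
           sum_distrib_left sum_divide_distrib simp flip: adopters_others)
    then show ?thesis
      using card_nonadopters(1)[OF that] by (simp add: hom_rate_def)
  qed
  then show ?thesis
    by (intro birth_tails_of_total_rate AE_I2) (auto dest: state_in)
qed

text \<open>The hypothesis \<open>reach\<close> excludes adoptions that precede node 1. With no
  adopter only the external rate of node 1 acts; afterwards all nonadopters have equal
  rates.\<close>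

lemma het_total_rate:
  assumes s: "s \<in> bass_states M" and M: "M \<ge> 2" and reach: "s 1 = 1 \<or> adopters M s = 0"
  shows "(\<Sum>j\<in>{j\<in>{1..M}. s j = 0}. adoption_rate M (het_external M p) (het_internal M q) s j) =
      het_rate M p (q / (real M - 1)) (adopters M s)"
  using reach
proof
  assume "adopters M s = 0"
  then have 0: "s j = 0" if "j \<in> {1..M}" for j
    using that by (auto simp: adopters_def)
  then have eq: "{j\<in>{1..M}. s j = 0} = {1..M}"
    by auto
  have "(\<Sum>j\<in>{1..M}. adoption_rate M (het_external M p) (het_internal M q) s j) =
      (\<Sum>j\<in>{1..M}. if j = 1 then real M * p else 0)"
    by (intro sum.cong) (auto simp: adoption_rate_def het_external_def 0)
  also have "\<dots> = real M * p"
    using M by (subst sum.delta) auto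
  finally show ?thesis
    using \<open>adopters M s = 0\<close> unfolding eq by (simp add: het_rate_def)
next
  assume 1: "s 1 = 1"
  let ?a = "q / (real M - 1)"
  have pos: "adopters M s \<noteq> 0"
    using 1 M by (auto simp: adopters_def intro!: bexI[of _ 1])
  have "adoption_rate M (het_external M p) (het_internal M q) s j = ?a + ?a * real (adopters M s)"
    if j: "j \<in> {1..M}" "s j = 0" for j
  proof -
    have j1: "j \<noteq> 1"
      using j 1 by auto
    \<comment> \<open>The double weight of node 1 is split into the common \<open>?a\<close> and an
      extra \<open>?a\<close>; node 1 is in the index set because
      \<open>j \<noteq> 1\<close>.\<close>
    have "adoption_rate M (het_external M p) (het_internal M q) s j =
        (\<Sum>k\<in>{1..M} - {j}. ?a * real (s k) + (if k = 1 then ?a else 0))"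
      unfolding adoption_rate_def using j1 1
      by (auto simp: het_external_def het_internal_def intro!: sum.cong split: if_splits
          simp flip: add_divide_distrib)
    also have "\<dots> = ?a * real (adopters M s) + ?a"
      using j1 M unfolding adopters_others[of s j M, OF j(2,1), symmetric]
      by (simp add: sum.distrib sum_distrib_left sum_divide_distrib)
    finally show ?thesis by simp
  qed
  then have "(\<Sum>j\<in>{j\<in>{1..M}. s j = 0}. adoption_rate M (het_external M p) (het_internal M q) s j) =
      (\<Sum>j\<in>{j\<in>{1..M}. s j = 0}. ?a + ?a * real (adopters M s))"
    by (intro sum.cong) auto
  then show ?thesis
    using card_nonadopters(1)[OF s] pos by (simp add: het_rate_def)
qed

text \<open>
  The indicator \<open>b\<close> of the states in which some node adopted although node 1 did not
  satisfies \<open>gen b = - M p b\<close>, since only node 1 can adopt spontaneously and nothing else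
  influences it.
\<close>

lemma het_node_1_first:
  assumes "discrete_bass N M (het_external M p) (het_internal M q) X" "M \<ge> 2" "t \<ge> 0"
  shows "AE \<omega> in N. X t \<omega> 1 = 1 \<or> adopters M (X t \<omega>) = 0"
proof -
  interpret discrete_bass N M "het_external M p" "het_internal M q" X
    by (rule assms)
  have M: "1 \<in> {1..M}"
    using assms(2) by auto
  define b :: "(nat \<Rightarrow> nat) \<Rightarrow> real" where "b s = of_bool (s 1 = 0 \<and> adopters M s \<noteq> 0)" for s
  have gen_b: "gen b s = - (real M * p) * b s" if s: "s \<in> bass_states M" for s
  proof (cases "s 1 = 0")
    case False
    then have "b s = 0" "b (s(j := 1)) = 0" for j
      by (auto simp: b_def)
    then show ?thesis
      unfolding gen_bass[OF s] by simp
  next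
    case True
    have "adoption_rate M (het_external M p) (het_internal M q) s j * (b (s(j := 1)) - b s) =
        (if j = 1 then - (real M * p) * b s else 0)" if j: "j \<in> {1..M}" "s j = 0" for j
    proof (cases "j = 1")
      case True
      then have "adoption_rate M (het_external M p) (het_internal M q) s j = real M * p"
        by (auto simp: adoption_rate_def het_external_def het_internal_def intro!: sum.neutral)
      then show ?thesis
        using True by (simp add: b_def)
    next
      \<comment> \<open>An adoption by another node has rate 0 if nobody has adopted, and otherwise
        leaves \<open>b\<close> unchanged.\<close>
      case j1: False
      show ?thesis
      proof (cases "adopters M s = 0")
        case True
        then have "s k = 0" if "k \<in> {1..M}" for k
          using that by (auto simp: adopters_def)
        then have "adoption_rate M (het_external M p) (het_internal M q) s j = 0"
          using j1 by (auto simp: adoption_rate_def het_external_def)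
        then show ?thesis
          using j1 by simp
      next
        case False
        then have "b (s(j := 1)) = b s"
          using j j1 adopters_adopt[of s j M] by (simp add: b_def)
        then show ?thesis
          using j1 by simp
      qed
    qed
    then have "gen b s = (\<Sum>j\<in>{j\<in>{1..M}. s j = 0}. if j = 1 then - (real M * p) * b s else 0)"
      unfolding gen_bass[OF s] by (intro sum.cong) auto
    also have "\<dots> = - (real M * p) * b s"
      using M True by (subst sum.delta) auto
    finally show ?thesis .
  qed
  define f where "f t = expectation (\<lambda>\<omega>. b (X t \<omega>))" for t
  \<comment> \<open>\<open>gronwall_le\<close> gives lower bounds, so an upper bound for
    \<open>f\<close> needs \<open>- f\<close>, here with zero source.\<close>
  have "((\<lambda>t. - f t) has_real_derivative 0 - real M * p * - f t) (at t within {0..})" if t: "t \<ge> 0" for t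
  proof -
    have "expectation (\<lambda>\<omega>. gen b (X t \<omega>)) = expectation (\<lambda>\<omega>. - (real M * p) * b (X t \<omega>))"
      using gen_b state_in[OF t] by (intro Bochner_Integration.integral_cong) auto
    then have "(f has_real_derivative - (real M * p) * f t) (at t within {0..})"
      using expectation_derivative[OF t, of b] by (simp add: f_def[abs_def])
    then show ?thesis
      by (auto intro!: derivative_eq_intros)
  qed
  then have "- f 0 \<le> exp (real M * p * t) * - f t"
    by (rule gronwall_le) (use assms in auto)
  moreover have "f 0 = expectation (\<lambda>_. 0)"
    unfolding f_def
    by (rule Bochner_Integration.integral_cong)
       (auto simp: b_def adopters_def initially_nonadopters)
  ultimately have "f t \<le> 0"
    by (simp add: mult_le_0_iff)
  moreover have "f t \<ge> 0"
    unfolding f_def by (rule Bochner_Integration.integral_nonneg) (simp add: b_def)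
  ultimately have "f t = 0"
    by simp
  moreover have "AE \<omega> in N. 0 \<le> b (X t \<omega>)"
    by (simp add: b_def)
  ultimately have "AE \<omega> in N. b (X t \<omega>) = 0"
    using integral_nonneg_eq_0_iff_AE[OF obs_integrable[OF assms(3), of b]]
    by (simp add: f_def)
  then show ?thesis
    using AE_space
  proof eventually_elim
    case (elim \<omega>)
    then show ?case
      using state_in[OF assms(3) elim(2)] M by (auto simp: b_def elim: bass_states_cases)
  qed
qed

lemma het_birth_tails:
  assumes "discrete_bass N M (het_external M p) (het_internal M q) X" "M \<ge> 2"
  shows "birth_tails (het_rate M p (q / (real M - 1))) (discrete_bass.tail N M X)"
proof -
  interpret discrete_bass N M "het_external M p" "het_internal M q" X
    by (rule assms)
  show ?thesis
  proof (rule birth_tails_of_total_rate)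
    fix t :: real assume t: "t \<ge> 0"
    show "AE \<omega> in N. (\<Sum>j\<in>{j\<in>{1..M}. X t \<omega> j = 0}.
        adoption_rate M (het_external M p) (het_internal M q) (X t \<omega>) j) =
        het_rate M p (q / (real M - 1)) (adopters M (X t \<omega>))"
      using het_node_1_first[OF assms t] AE_space
      by eventually_elim (intro het_total_rate assms state_in[OF t])
  qed
qed

theorem lemma8:
  fixes M :: nat and p q t :: real
    and N_hom :: "'a measure" and X_hom :: "real \<Rightarrow> 'a \<Rightarrow> nat \<Rightarrow> nat"
    and N_het :: "'b measure" and X_het :: "real \<Rightarrow> 'b \<Rightarrow> nat \<Rightarrow> nat"
  assumes "M \<ge> 2" and "p > 0" and "q \<ge> 0"
    and "discrete_bass N_hom M (hom_external p) (hom_internal M q) X_hom"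
    and "discrete_bass N_het M (het_external M p) (het_internal M q) X_het"
    and "t > 0"
  shows "(q / (real M - 1) > p \<longrightarrow> adopter_fraction N_het M X_het t > adopter_fraction N_hom M X_hom t) \<and>
    (q / (real M - 1) = p \<longrightarrow> adopter_fraction N_het M X_het t = adopter_fraction N_hom M X_hom t) \<and>
    (q / (real M - 1) < p \<longrightarrow> adopter_fraction N_het M X_het t < adopter_fraction N_hom M X_hom t)"
proof -
  define a where "a = q / (real M - 1)"
  have a: "a \<ge> 0"
    using assms by (simp add: a_def)
  interpret hom: birth_tails "hom_rate M p a" "discrete_bass.tail N_hom M X_hom"
    unfolding a_def by (rule hom_birth_tails) fact
  interpret het: birth_tails "het_rate M p a" "discrete_bass.tail N_het M X_het"
    unfolding a_def by (rule het_birth_tails) fact+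
  \<comment> \<open>The comparison is one-directional, so each order of the two processes is
    interpreted: \<open>up\<close> serves \<open>p \<le> a\<close>, \<open>down\<close> serves
    \<open>a \<le> p\<close>.\<close>
  interpret up: birth_tails_pair "hom_rate M p a" "discrete_bass.tail N_hom M X_hom"
    "het_rate M p a" "discrete_bass.tail N_het M X_het" ..
  interpret down: birth_tails_pair "het_rate M p a" "discrete_bass.tail N_het M X_het"
    "hom_rate M p a" "discrete_bass.tail N_hom M X_hom" ..
  have rate_pos: "0 \<le> hom_rate M p a n" "0 \<le> het_rate M p a n"
      "0 < hom_rate M p a 0" "0 < het_rate M p a 0" for n
    using a assms by (auto simp: hom_rate_def het_rate_def)
  \<comment> \<open>At 0 both rates are \<open>M * p\<close>; for positive \<open>n\<close> the
    factors \<open>p + a * n\<close> and \<open>a + a * n\<close> are compared.\<close>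
  have le: "hom_rate M p a n \<le> het_rate M p a n" if "p \<le> a" for n
    using that by (auto simp: hom_rate_def het_rate_def intro: mult_left_mono)
  have ge: "het_rate M p a n \<le> hom_rate M p a n" if "a \<le> p" for n
    using that by (auto simp: hom_rate_def het_rate_def intro: mult_left_mono)
  have fractions:
    "adopter_fraction N_hom M X_hom t = 1 / real M * (\<Sum>k\<in>{1..M}. discrete_bass.tail N_hom M X_hom k t)"
    "adopter_fraction N_het M X_het t = 1 / real M * (\<Sum>k\<in>{1..M}. discrete_bass.tail N_het M X_het k t)"
    using discrete_bass.adopter_fraction_eq_tails assms by (metis less_imp_le)+
  have "adopter_fraction N_het M X_het t > adopter_fraction N_hom M X_hom t" if "a > p"
  proof -
    have "hom_rate M p a 1 < het_rate M p a 1"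
      using that assms by (simp add: hom_rate_def het_rate_def)
    then show ?thesis
      unfolding fractions using up.sum_tails_less[of t M] rate_pos le that assms
      by (simp add: divide_strict_right_mono)
  qed
  moreover have "adopter_fraction N_het M X_het t < adopter_fraction N_hom M X_hom t" if "a < p"
  proof -
    have "het_rate M p a 1 < hom_rate M p a 1"
      using that assms by (simp add: hom_rate_def het_rate_def)
    then show ?thesis
      unfolding fractions using down.sum_tails_less[of t M] rate_pos ge that assms
      by (simp add: divide_strict_right_mono)
  qed
  \<comment> \<open>For equal rates both comparisons apply, and antisymmetry identifies the tails
    one by one.\<close>
  moreover have "adopter_fraction N_het M X_het t = adopter_fraction N_hom M X_hom t" if "a = p"
    unfolding fractions using up.tail_le[of t] down.tail_le[of t] rate_pos le ge that assms
    by (intro arg_cong2[where f = "(*)"] sum.cong antisym) auto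
  ultimately show ?thesis
    by (simp add: a_def)
qed

end
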